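(* Let $X_1,\ldots,X_l$ be independent random variables and let $E_1,\ldots,E_m$ be events, each $E_j$ depending only on the variables in its scope $\mathrm{sc}(E_j)$. For each $j$, let $\Gamma_j=\{i : E_i \text{ is } d\text{-dependent on } E_j\}$ be the outwards neighborhood of $E_j$ in the $d$-dependency graph. Suppose that there exist $\chi_1,\chi_2,\ldots,\chi_m\in(0,1)$ such that $$\Pr(E_j)\leq \chi_j \prod_{i\in \Gamma_j} (1-\chi_i)\quad\text{for all } j\in\{1,\ldots,m\}.$$ Then the probability that M-Algorithm executes for at least $n$ rounds is inverse exponential in $n$; that is, there are constants $C>0$ and $c\in(0,1)$, not depending on $n$, such that this probability is at most $C\,c^n$ for all $n\ge 1$.
   Context: Variable framework: the probability space is the product space of independent random variables $X_1,\ldots,X_l$; each event $E_j$ is determined by the values of a subset $\mathrm{sc}(E_j)$ of these variables, called its scope. Throughout, $\Pr[E_j]<1$ for all $j$. The numbers $l$ of variables and $m$ of events are constants; asymptotics are with respect to $n$ only. $d$-dependency: $E_i$ is $d$-dependent on $E_j$ if there exists an assignment $\alpha$ of values to $X_1,\ldots,X_l$ under which $E_j$ occurs and $E_i$ does not, and such that the values of the variables in $\mathrm{sc}(E_j)$ can be changed (all other values of $\alpha$ being kept) so that $E_i$ occurs and $E_j$ ceases occurring. The $d$-dependency graph is the directed graph on $\{1,\ldots,m\}$ with an edge $(j,i)$ whenever $E_i$ is $d$-dependent on $E_j$. M-Algorithm: sample (independently, from their distributions) the variables $X_1,\ldots,X_l$. While some event occurs under the current assignment, let $E_j$ be the least indexed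 such event and call Resample($E_j$). When no event occurs, output the current assignment and stop. Resample($E_j$) is the following recursive routine: (1) resample independently the variables in $\mathrm{sc}(E_j)$; (2) if $E_j$ occurs under the new assignment, call Resample($E_j$); (3) otherwise, while some event whose index is in $\Gamma_j$ occurs under the current assignment, let $E_k$ be the least indexed such event and call Resample($E_k$). A round is the duration of any Resample call (root or recursive; rounds are nested); the algorithm executes for at least $n$ rounds if at least $n$ Resample calls are made in total, i.e. step (1) of Resample is executed at least $n$ times. *)

theory Defs
  imports "HOL-Probability.Probability"
begin

text \<open>
  Variables are indexed by \<open>{1..l}\<close> and events by \<open>{1..m}\<close>. The variable \<open>X\<^sub>i\<close> is the \<open>i\<close>-th
  coordinate of the product space, with distribution \<open>M i\<close>; no finiteness or discreteness of the
  \<open>M i\<close> is assumed. They share a carrier type, but \<open>space (M i)\<close> may be any subset of it.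
\<close>

type_synonym 'a assignment = "nat \<Rightarrow> 'a"

abbreviation var_space :: "nat \<Rightarrow> (nat \<Rightarrow> 'a measure) \<Rightarrow> 'a assignment measure" where
  "var_space l M \<equiv> Pi\<^sub>M {1..l} M"

definition determined_by :: "'a assignment measure \<Rightarrow> 'a assignment set \<Rightarrow> nat set \<Rightarrow> bool" where
  "determined_by P A S \<longleftrightarrow>
     (\<forall>\<alpha>\<in>space P. \<forall>\<beta>\<in>space P. (\<forall>i\<in>S. \<alpha> i = \<beta> i) \<longrightarrow> (\<alpha> \<in> A \<longleftrightarrow> \<beta> \<in> A))"

text \<open>\<open>d_dependent P E sc i j\<close>: the event \<open>E i\<close> is d-dependent on \<open>E j\<close>.\<close>

definition d_dependent ::
    "'a assignment measure \<Rightarrow> (nat \<Rightarrow> 'a assignment set) \<Rightarrow> (nat \<Rightarrow> nat set) \<Rightarrow> nat \<Rightarrow> nat \<Rightarrow> bool"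
  where
  "d_dependent P E sc i j \<longleftrightarrow>
     (\<exists>\<alpha>\<in>space P. \<exists>\<beta>\<in>space P. \<alpha> \<in> E j \<and> \<alpha> \<notin> E i \<and>
        (\<forall>k. k \<notin> sc j \<longrightarrow> \<beta> k = \<alpha> k) \<and> \<beta> \<in> E i \<and> \<beta> \<notin> E j)"

definition d_dependency_graph ::
    "nat \<Rightarrow> 'a assignment measure \<Rightarrow> (nat \<Rightarrow> 'a assignment set) \<Rightarrow> (nat \<Rightarrow> nat set) \<Rightarrow> (nat \<times> nat) set"
  where
  "d_dependency_graph m P E sc =
     {(j, i). j \<in> {1..m} \<and> i \<in> {1..m} \<and> d_dependent P E sc i j}"

definition out_nbhd ::
    "nat \<Rightarrow> 'a assignment measure \<Rightarrow> (nat \<Rightarrow> 'a assignment set) \<Rightarrow> (nat \<Rightarrow> nat set) \<Rightarrow> nat \<Rightarrow> nat set"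
  where
  "out_nbhd m P E sc j = d_dependency_graph m P E sc `` {j}"

text \<open>
  The recursive algorithm is run by an explicit control stack. \<open>Call j\<close> is a pending call of
  Resample for \<open>E j\<close> (about to execute step 1); \<open>Scan j\<close> is such a call that has reached its
  while loop (step 3). The empty stack is the main loop. The recursive call in step 2 is the last
  action of its caller, so it leaves no frame behind.

  Randomness is an i.i.d. stream of full assignments: the head is the initial sample, and each
  execution of step 1 consumes the next element, of which only the coordinates in the scope are
  used.

  A configuration consists of the stack, the current assignment, the unused part of the stream,
  and the number of executions of step 1 so far.
\<close>

datatype frame = Call nat | Scan nat

type_synonym 'a config = "frame list \<times> 'a assignment \<times> 'a assignment stream \<times> nat"

definition least_occurring :: "(nat \<Rightarrow> 'a assignment set) \<Rightarrow> nat set \<Rightarrow> 'a assignment \<Rightarrow> nat" where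
  "least_occurring E A \<alpha> = (LEAST k. k \<in> A \<and> \<alpha> \<in> E k)"

fun m_step ::
    "nat \<Rightarrow> (nat \<Rightarrow> 'a assignment set) \<Rightarrow> (nat \<Rightarrow> nat set) \<Rightarrow> (nat \<Rightarrow> nat set) \<Rightarrow> 'a config \<Rightarrow> 'a config"
  where
  "m_step m E sc \<Gamma> ([], \<alpha>, \<omega>, r) =
     (if \<exists>j\<in>{1..m}. \<alpha> \<in> E j
      then ([Call (least_occurring E {1..m} \<alpha>)], \<alpha>, \<omega>, r)
      else ([], \<alpha>, \<omega>, r))"
| "m_step m E sc \<Gamma> (Call j # s, \<alpha>, \<omega>, r) =
     (let \<beta> = override_on \<alpha> (shd \<omega>) (sc j)
      in (if \<beta> \<in> E j then Call j # s else Scan j # s, \<beta>, stl \<omega>, Suc r))"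
| "m_step m E sc \<Gamma> (Scan j # s, \<alpha>, \<omega>, r) =
     (if \<exists>k\<in>\<Gamma> j. \<alpha> \<in> E k
      then (Call (least_occurring E (\<Gamma> j) \<alpha>) # Scan j # s, \<alpha>, \<omega>, r)
      else (s, \<alpha>, \<omega>, r))"

definition m_config ::
    "nat \<Rightarrow> (nat \<Rightarrow> 'a assignment set) \<Rightarrow> (nat \<Rightarrow> nat set) \<Rightarrow> (nat \<Rightarrow> nat set) \<Rightarrow>
     'a assignment stream \<Rightarrow> nat \<Rightarrow> 'a config"
  where
  "m_config m E sc \<Gamma> \<omega> t = (m_step m E sc \<Gamma> ^^ t) ([], shd \<omega>, stl \<omega>, 0)"

definition rounds :: "'a config \<Rightarrow> nat" where
  "rounds c = snd (snd (snd c))"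

definition at_least_rounds ::
    "nat \<Rightarrow> 'a assignment measure \<Rightarrow> (nat \<Rightarrow> 'a assignment set) \<Rightarrow> (nat \<Rightarrow> nat set) \<Rightarrow> nat \<Rightarrow>
     'a assignment stream set"
  where
  "at_least_rounds m P E sc n =
     {\<omega> \<in> space (stream_space P). \<exists>t. n \<le> rounds (m_config m E sc (out_nbhd m P E sc) \<omega> t)}"

definition frames :: "nat \<Rightarrow> frame set" where
  "frames m = Call ` {1..m} \<union> Scan ` {1..m}"

lemma least_occurring_mem:
  assumes "\<exists>k\<in>A. \<alpha> \<in> E k"
  shows "least_occurring E A \<alpha> \<in> A" "\<alpha> \<in> E (least_occurring E A \<alpha>)"
proof -
  from assms have "\<exists>k. k \<in> A \<and> \<alpha> \<in> E k" by blast
  from LeastI_ex[OF this] have "least_occurring E A \<alpha> \<in> A \<and> \<alpha> \<in> E (least_occurring E A \<alpha>)"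
    unfolding least_occurring_def .
  then show "least_occurring E A \<alpha> \<in> A" "\<alpha> \<in> E (least_occurring E A \<alpha>)" by auto
qed

lemma frame_stack_cases [case_names Nil Call Scan]:
  obtains "x = []" | j s where "x = Call j # s" | j s where "x = Scan j # s"
  by (metis frame.exhaust list.exhaust)

lemma measurable_count_space_restrict:
  assumes "f \<in> N \<rightarrow>\<^sub>M count_space UNIV" "f \<in> space N \<rightarrow> S"
  shows "f \<in> N \<rightarrow>\<^sub>M count_space S"
  using assms by (intro measurableI) (simp_all add: Pi_iff measurable_sets)

lemma out_nbhd_subset: "out_nbhd m P E sc j \<subseteq> {1..m}"
  by (auto simp: out_nbhd_def d_dependency_graph_def)

lemma measurable_override_on:
  assumes "S \<subseteq> {1..l}"
  shows "(\<lambda>(\<alpha>, \<beta>). override_on \<alpha> \<beta> S) \<in> var_space l M \<Otimes>\<^sub>M var_space l M \<rightarrow>\<^sub>M var_space l M"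
proof (rule measurable_PiM_single')
  fix i assume i: "i \<in> {1..l}"
  show "(\<lambda>x. (case x of (\<alpha>, \<beta>) \<Rightarrow> override_on \<alpha> \<beta> S) i) \<in> var_space l M \<Otimes>\<^sub>M var_space l M \<rightarrow>\<^sub>M M i"
    using i by (cases "i \<in> S") (auto simp: override_on_def case_prod_beta)
next
  show "(\<lambda>x. case x of (\<alpha>, \<beta>) \<Rightarrow> override_on \<alpha> \<beta> S) \<in>
      space (var_space l M \<Otimes>\<^sub>M var_space l M) \<rightarrow> (\<Pi>\<^sub>E i\<in>{1..l}. space (M i))"
    using assms by (fastforce simp: override_on_def space_pair_measure space_PiM PiE_iff extensional_def)
qed

lemma measurable_least_occurring:
  assumes "\<And>k. k \<in> A \<Longrightarrow> E k \<in> sets P"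
  shows "{\<alpha> \<in> space P. \<exists>k\<in>A. \<alpha> \<in> E k} \<in> sets P"
    "least_occurring E A \<in> P \<rightarrow>\<^sub>M count_space UNIV"
proof -
  have p: "Measurable.pred P (\<lambda>\<alpha>. k \<in> A \<and> \<alpha> \<in> E k)" for k
    using assms by (cases "k \<in> A") auto
  have "{\<alpha> \<in> space P. \<exists>k. k \<in> A \<and> \<alpha> \<in> E k} \<in> sets P"
    using p by measurable
  then show "{\<alpha> \<in> space P. \<exists>k\<in>A. \<alpha> \<in> E k} \<in> sets P" by (simp add: Bex_def)
  show "least_occurring E A \<in> P \<rightarrow>\<^sub>M count_space UNIV"
    unfolding least_occurring_def using p by measurable
qed

text \<open>Without measurability of this event its measure would be \<open>0\<close> by convention.\<close>

lemma at_least_rounds_measurable: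
  fixes M :: "nat \<Rightarrow> 'a measure"
  assumes sc: "\<And>j. j \<in> {1..m} \<Longrightarrow> sc j \<subseteq> {1..l}"
    and E: "\<And>j. j \<in> {1..m} \<Longrightarrow> E j \<in> sets (var_space l M)"
  shows "at_least_rounds m (var_space l M) E sc n \<in> sets (stream_space (var_space l M))"
proof -
  define P where "P = var_space l M"
  define \<Gamma> where "\<Gamma> = out_nbhd m P E sc"
  define S where "S = lists (frames m)"
  define N where "N = P \<Otimes>\<^sub>M stream_space P \<Otimes>\<^sub>M (count_space UNIV :: nat measure)"
  have E': "E j \<in> sets P" if "j \<in> {1..m}" for j using E that by (simp add: P_def)
  have \<Gamma>: "\<Gamma> j \<subseteq> {1..m}" for j unfolding \<Gamma>_def by (rule out_nbhd_subset)
  have cS: "countable S" unfolding S_def frames_def by (intro countable_lists) auto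
  have push: "(\<lambda>y. if \<exists>k\<in>A. fst y \<in> E k then (Call (least_occurring E A (fst y)) # s, y) else (s', y))
      \<in> N \<rightarrow>\<^sub>M count_space S \<Otimes>\<^sub>M N" if A: "A \<subseteq> {1..m}" and s: "s \<in> S" "s' \<in> S" for A s s'
  proof -
    have EA: "\<And>k. k \<in> A \<Longrightarrow> E k \<in> sets P" using A E' by auto
    have f: "fst \<in> N \<rightarrow>\<^sub>M P" unfolding N_def by simp
    have p: "Measurable.pred N (\<lambda>y. \<exists>k\<in>A. fst y \<in> E k)"
      using measurable_compose[OF f, of "\<lambda>\<alpha>. \<exists>k\<in>A. \<alpha> \<in> E k"] measurable_least_occurring(1)[OF EA]
      by (simp add: pred_def)
    have g: "(\<lambda>y. least_occurring E A (fst y)) \<in> N \<rightarrow>\<^sub>M count_space UNIV"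
      using measurable_compose[OF f measurable_least_occurring(2)[OF EA]] by simp
    have h: "(\<lambda>y. if \<exists>k\<in>A. fst y \<in> E k then Call (least_occurring E A (fst y)) # s else s')
        \<in> N \<rightarrow>\<^sub>M count_space UNIV"
      by (rule measurable_If[OF measurable_compose[OF g] _ p[unfolded pred_def]]) auto
    have "(\<lambda>y. if \<exists>k\<in>A. fst y \<in> E k then Call (least_occurring E A (fst y)) # s else s')
        \<in> space N \<rightarrow> S"
    proof (rule Pi_I)
      fix y
      have "Call (least_occurring E A (fst y)) \<in> frames m" if "\<exists>k\<in>A. fst y \<in> E k"
        unfolding frames_def using least_occurring_mem(1)[OF that] A by blast
      then show "(if \<exists>k\<in>A. fst y \<in> E k then Call (least_occurring E A (fst y)) # s else s') \<in> S"
        using s by (simp add: S_def)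
    qed
    from measurable_count_space_restrict[OF h this] have h': "(\<lambda>y. if \<exists>k\<in>A. fst y \<in> E k then Call (least_occurring E A (fst y)) # s else s')
        \<in> N \<rightarrow>\<^sub>M count_space S"
      .
    have "(\<lambda>y. (if \<exists>k\<in>A. fst y \<in> E k then Call (least_occurring E A (fst y)) # s else s', y))
        \<in> N \<rightarrow>\<^sub>M count_space S \<Otimes>\<^sub>M N"
      using h' by (intro measurable_Pair) auto
    then show ?thesis by (rule measurable_cong[THEN iffD1, rotated]) auto
  qed
  have pull: "(\<lambda>y. (if override_on (fst y) (shd (fst (snd y))) (sc j) \<in> E j then Call j # s else Scan j # s,
        override_on (fst y) (shd (fst (snd y))) (sc j), stl (fst (snd y)), Suc (snd (snd y))))
      \<in> N \<rightarrow>\<^sub>M count_space S \<Otimes>\<^sub>M N" if j: "j \<in> {1..m}" and s: "s \<in> S" for j s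
  proof -
    have "(\<lambda>y. (fst y, shd (fst (snd y)))) \<in> N \<rightarrow>\<^sub>M P \<Otimes>\<^sub>M P"
      unfolding N_def by measurable
    from measurable_compose[OF this[unfolded P_def] measurable_override_on[OF sc[OF j]]]
    have b: "(\<lambda>y. override_on (fst y) (shd (fst (snd y))) (sc j)) \<in> N \<rightarrow>\<^sub>M P"
      by (simp add: P_def)
    have p: "Measurable.pred N (\<lambda>y. override_on (fst y) (shd (fst (snd y))) (sc j) \<in> E j)"
      by (rule measurable_compose[OF b]) (use E'[OF j] in measurable)
    have "Call j # s \<in> S" "Scan j # s \<in> S" using j s by (auto simp: S_def frames_def)
    then have "(\<lambda>y. if override_on (fst y) (shd (fst (snd y))) (sc j) \<in> E j then Call j # s else Scan j # s)
        \<in> N \<rightarrow>\<^sub>M count_space S"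
      by (intro measurable_If[OF _ _ p[unfolded pred_def]]) auto
    moreover have "(\<lambda>y. (stl (fst (snd y)), Suc (snd (snd y))))
        \<in> N \<rightarrow>\<^sub>M stream_space P \<Otimes>\<^sub>M (count_space UNIV :: nat measure)"
      unfolding N_def by measurable
    ultimately show ?thesis using b unfolding N_def by (intro measurable_Pair) auto
  qed
  have step: "m_step m E sc \<Gamma> \<in> count_space S \<Otimes>\<^sub>M N \<rightarrow>\<^sub>M count_space S \<Otimes>\<^sub>M N"
  proof (rule measurable_pair_measure_countable1[OF cS])
    fix x assume x: "x \<in> S"
    show "(\<lambda>y. m_step m E sc \<Gamma> (x, y)) \<in> N \<rightarrow>\<^sub>M count_space S \<Otimes>\<^sub>M N"
    proof (cases x rule: frame_stack_cases)
      case Nil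
      have "(\<lambda>y. m_step m E sc \<Gamma> (x, y)) = (\<lambda>y. if \<exists>k\<in>{1..m}. fst y \<in> E k
          then ([Call (least_occurring E {1..m} (fst y))], y) else ([], y))"
        using Nil by (auto simp: fun_eq_iff)
      then show ?thesis using push[of "{1..m}" "[]" "[]"] by (simp add: S_def)
    next
      case (Call j s)
      have "(\<lambda>y. m_step m E sc \<Gamma> (x, y)) = (\<lambda>y.
         (if override_on (fst y) (shd (fst (snd y))) (sc j) \<in> E j then Call j # s else Scan j # s,
          override_on (fst y) (shd (fst (snd y))) (sc j), stl (fst (snd y)), Suc (snd (snd y))))"
        using Call by (auto simp: fun_eq_iff Let_def)
      moreover have "j \<in> {1..m}" "s \<in> S" using Call x by (auto simp: S_def frames_def)
      ultimately show ?thesis using pull[of j s] by simp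
    next
      case (Scan j s)
      have "(\<lambda>y. m_step m E sc \<Gamma> (x, y)) = (\<lambda>y. if \<exists>k\<in>\<Gamma> j. fst y \<in> E k
          then (Call (least_occurring E (\<Gamma> j) (fst y)) # Scan j # s, y) else (s, y))"
        using Scan by (auto simp: fun_eq_iff)
      moreover have "s \<in> S" using Scan x by (auto simp: S_def)
      ultimately show ?thesis using push[OF \<Gamma>, of "Scan j # s" s j] x Scan by simp
    qed
  qed
  have init: "(\<lambda>\<omega>. ([], shd \<omega>, stl \<omega>, 0)) \<in> stream_space P \<rightarrow>\<^sub>M count_space S \<Otimes>\<^sub>M N"
    unfolding N_def by (intro measurable_Pair) (auto simp: S_def)
  have conf: "(\<lambda>\<omega>. m_config m E sc \<Gamma> \<omega> t) \<in> stream_space P \<rightarrow>\<^sub>M count_space S \<Otimes>\<^sub>M N" for t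
  proof (induction t)
    case 0
    show ?case using init by (simp add: m_config_def)
  next
    case (Suc t)
    show ?case using measurable_compose[OF Suc step] by (simp add: m_config_def)
  qed
  have "(\<lambda>\<omega>. rounds (m_config m E sc \<Gamma> \<omega> t)) \<in> stream_space P \<rightarrow>\<^sub>M count_space UNIV" for t
    unfolding rounds_def using conf[of t] unfolding N_def by measurable
  then have "{\<omega> \<in> space (stream_space P). \<exists>t. n \<le> rounds (m_config m E sc \<Gamma> \<omega> t)} \<in> sets (stream_space P)"
    by measurable
  then show ?thesis by (simp add: at_least_rounds_def P_def \<Gamma>_def)
qed

end

(*
A completed Resample call for E_j leaves E_j and every event of Gamma_j not occurring, and makes no
other event occur that did not occur before. Hence each while loop calls Resample on strictly
increasing indices, and a run is coded by a forest in which a node j has either a single child j or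
a set of children contained in Gamma_j. Conditioning on E_j and then resampling sc(E_j) restores the
product distribution, so a given forest is followed with probability at most the product of the
p_j = Pr(E_j) over its nodes. If p_j (q_j + prod_{i in Gamma_j} (1 + q_i)) <= c q_j for all j, then
by induction on n the total weight of the forests with n nodes is O(c^n). Such q and c < 1 are
obtained from q_j = chi_j / (1 - chi_j), slightly increased where Gamma_j is empty.
*)
theory Submission
  imports Defs
begin

section \<open>Weights with slack from the local lemma condition\<close>

text \<open>Expanding the product over subsets of \<open>R\<close> and sorting the nonempty ones by
  their least element \<open>k\<close> gives the sum. A loop selecting strictly increasing indices
  is counted in the same way.\<close>

lemma prod_one_plus_eq_sum:
  fixes f :: "'b :: linorder \<Rightarrow> 'c :: comm_semiring_1"
  assumes "finite R"
  shows "(\<Prod>i\<in>R. 1 + f i) = 1 + (\<Sum>k\<in>R. f k * (\<Prod>i\<in>R \<inter> {k<..}. 1 + f i))"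
  using assms
proof (induction R rule: finite_linorder_min_induct)
  case (insert b R)
  have "insert b R \<inter> {b<..} = R" using insert.hyps by auto
  moreover have "insert b R \<inter> {k<..} = R \<inter> {k<..}" if "k \<in> R" for k
    using insert.hyps that by fastforce
  moreover have "b \<notin> R" using insert.hyps by auto
  ultimately show ?case
    using insert by (simp add: algebra_simps cong: sum.cong)
qed simp

lemma cluster_weights:
  fixes chi p :: "nat \<Rightarrow> real" and \<Gamma> :: "nat \<Rightarrow> nat set"
  assumes J: "finite J" and \<Gamma>: "\<And>j. j \<in> J \<Longrightarrow> \<Gamma> j \<subseteq> J"
    and p0: "\<And>j. j \<in> J \<Longrightarrow> 0 \<le> p j"
    and chi: "\<And>j. j \<in> J \<Longrightarrow> 0 < chi j \<and> chi j < 1"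
    and p: "\<And>j. j \<in> J \<Longrightarrow> p j \<le> chi j * (\<Prod>i\<in>\<Gamma> j. 1 - chi i)"
  shows "\<exists>q c. 0 < c \<and> c < 1 \<and>
    (\<forall>j\<in>J. 0 < q j \<and> p j * (q j + (\<Prod>i\<in>\<Gamma> j. 1 + q i)) \<le> c * q j)"
proof -
  \<comment> \<open>For \<open>d = 0\<close> the inequality is strict unless \<open>\<Gamma> j = {}\<close>, and in that case it becomes strict for
    every \<open>d > 0\<close>; a small \<open>d > 0\<close> therefore makes all of them strict.\<close>
  define q where "q d j = chi j / (1 - chi j) + (if \<Gamma> j = {} then d else 0)" for d j
  have q_pos: "0 < q d j" if "j \<in> J" "0 \<le> d" for d j
    using chi[OF that(1)] that(2) by (auto simp: q_def add_pos_nonneg)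
  have "\<forall>\<^sub>F d in at_right 0. p j * (q d j + (\<Prod>i\<in>\<Gamma> j. 1 + q d i)) < q d j" if j: "j \<in> J" for j
  proof (cases "\<Gamma> j = {}")
    case True
    have pj: "p j \<le> chi j" using p[OF j] True by simp
    have "p j * (q d j + 1) < q d j" if d: "0 < d" for d
    proof -
      have "p j * (q d j + 1) \<le> chi j * (q d j + 1)"
        using pj q_pos[OF j, of d] d by (intro mult_right_mono) auto
      also have "\<dots> < q d j"
      proof -
        \<comment> \<open>\<open>chi j / (1 - chi j)\<close> is the fixed point of the map x ->
          \<open>chi j * (x + 1)\<close>, whose slope is below 1, so every positive shift gains
          strictly.\<close>
        have "chi j * (chi j / (1 - chi j) + 1) = chi j / (1 - chi j)"
          using chi[OF j] by (simp add: field_simps)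
        moreover have "chi j * d < d" using chi[OF j] d by simp
        ultimately show ?thesis using True by (simp add: q_def algebra_simps)
      qed
      finally show ?thesis .
    qed
    then show ?thesis using True by (auto simp: eventually_at_filter)
  next
    case False
    have fin: "finite (\<Gamma> j)" using \<Gamma>[OF j] J by (rule finite_subset)
    have chi': "0 < 1 - chi i" "1 - chi i < 1" if "i \<in> \<Gamma> j" for i
      using chi \<Gamma>[OF j] that by auto
    have "(\<Prod>i\<in>\<Gamma> j. 1 - chi i) < 1"
    proof -
      obtain i where i: "i \<in> \<Gamma> j" using False by blast
      have "(\<Prod>i\<in>\<Gamma> j. 1 - chi i) < (\<Prod>i\<in>\<Gamma> j. 1)"
        by (rule prod_mono_strict[OF i]) (use chi' i fin in \<open>auto intro: less_imp_le\<close>)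
      then show ?thesis by simp
    qed
    \<comment> \<open>Strictness is gained only in the summand \<open>p j * q 0 j\<close>; the other
      summand is merely bounded by \<open>chi j\<close>.\<close>
    then have p_less: "p j < chi j"
      using p[OF j] chi[OF j] by (smt (verit) mult_less_cancel_left2)
    have "p j * (\<Prod>i\<in>\<Gamma> j. 1 + q 0 i) = p j / (\<Prod>i\<in>\<Gamma> j. 1 - chi i)"
    proof -
      have "1 + q 0 i = inverse (1 - chi i)" if "i \<in> \<Gamma> j" for i
        using chi'[OF that] by (simp add: q_def field_simps)
      then show ?thesis by (simp add: divide_inverse prod_inversef[unfolded o_def])
    qed
    also have "\<dots> \<le> chi j"
      using p[OF j] chi' by (simp add: divide_le_eq prod_pos)
    finally have "p j * (q 0 j + (\<Prod>i\<in>\<Gamma> j. 1 + q 0 i)) < chi j * q 0 j + chi j"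
      using p_less q_pos[OF j, of 0] by (simp add: distrib_left add_less_le_mono)
    also have "\<dots> = q 0 j"
      using chi[OF j] by (simp add: q_def field_simps)
    finally have 0: "p j * (q 0 j + (\<Prod>i\<in>\<Gamma> j. 1 + q 0 i)) < q 0 j" .
    have q_lim: "((\<lambda>d. q d i) \<longlongrightarrow> q 0 i) (at_right 0)" for i
      unfolding q_def by (cases "\<Gamma> i = {}") (auto intro!: tendsto_eq_intros)
    have "((\<lambda>d. q d j - p j * (q d j + (\<Prod>i\<in>\<Gamma> j. 1 + q d i))) \<longlongrightarrow>
        q 0 j - p j * (q 0 j + (\<Prod>i\<in>\<Gamma> j. 1 + q 0 i))) (at_right 0)"
      by (intro tendsto_intros q_lim)
    then show ?thesis
      using order_tendstoD(1)[of _ _ _ 0] 0 by fastforce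
  qed
  then have "\<forall>\<^sub>F d in at_right 0. 0 < d \<and> (\<forall>j\<in>J. p j * (q d j + (\<Prod>i\<in>\<Gamma> j. 1 + q d i)) < q d j)"
    using J by (auto simp: eventually_conj_iff eventually_ball_finite eventually_at_right_less)
  then obtain d where d: "0 < d" "\<And>j. j \<in> J \<Longrightarrow> p j * (q d j + (\<Prod>i\<in>\<Gamma> j. 1 + q d i)) < q d j"
    using eventually_happens'[OF trivial_limit_at_right_real] by blast
  define r where "r j = p j * (q d j + (\<Prod>i\<in>\<Gamma> j. 1 + q d i)) / q d j" for j
  \<comment> \<open>The entry \<open>1/2\<close> keeps \<open>c\<close> positive, and the maximum
    defined when \<open>J\<close> is empty.\<close>
  define c where "c = Max (insert (1/2) (r ` J))"
  have "r j < 1" if "j \<in> J" for j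
    using d(2)[OF that] q_pos[OF that, of d] d(1) by (simp add: r_def)
  then have "c < 1" using J by (simp add: c_def)
  moreover have "0 < c"
    using J by (simp add: c_def Max_gr_iff)
  moreover have "p j * (q d j + (\<Prod>i\<in>\<Gamma> j. 1 + q d i)) \<le> c * q d j" if "j \<in> J" for j
  proof -
    have "r j \<le> c" using J that by (simp add: c_def)
    then show ?thesis using q_pos[OF that, of d] d(1) by (simp add: r_def divide_le_eq)
  qed
  ultimately show ?thesis using q_pos[of _ d] d(1) by (intro exI[of _ "q d"] exI[of _ c]) auto
qed

section \<open>Resampling after conditioning on an event\<close>

text \<open>The set \<open>A\<close> constrains only the coordinates of \<alpha> in
  \<open>S\<close>, and these are exactly the ones that the override discards. The two factors thus
  depend on independent coordinates, and the refreshed point has the product law again.\<close>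

lemma nn_integral_resample:
  fixes M :: "nat \<Rightarrow> 'a measure"
  assumes M: "\<And>i. i \<in> {1..l} \<Longrightarrow> prob_space (M i)"
    and S: "S \<subseteq> {1..l}"
    and A [measurable]: "A \<in> sets (var_space l M)"
    and det: "determined_by (var_space l M) A S"
    and h [measurable]: "h \<in> borel_measurable (var_space l M)"
  shows "(\<integral>\<^sup>+\<alpha>. \<integral>\<^sup>+x. indicator A \<alpha> * h (override_on \<alpha> x S) \<partial>var_space l M \<partial>var_space l M) =
    emeasure (var_space l M) A * (\<integral>\<^sup>+x. h x \<partial>var_space l M)"
proof -
  \<comment> \<open>One-point spaces fill the indices outside \<open>{1..l}\<close>, since
    \<open>product_sigma_finite\<close> wants a measure at every index.\<close>
  define M' where "M' i = (if i \<in> {1..l} then M i else count_space {undefined})" for i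
  have pM': "prob_space (M' i)" for i
    using M by (auto simp: M'_def intro!: prob_spaceI)
  interpret M': prob_space "M' i" for i by (rule pM')
  interpret product_sigma_finite M' by unfold_locales
  define T where "T = {1..l} - S"
  define P where "P = Pi\<^sub>M (S \<union> T) M'"
  have P_eq: "var_space l M = P"
    unfolding P_def using S by (intro PiM_cong) (auto simp: M'_def T_def)
  have ST: "S \<inter> T = {}" "finite S" "finite T"
    using S finite_subset[OF S] by (auto simp: T_def)
  interpret PS: prob_space "Pi\<^sub>M S M'" by (intro prob_space_PiM pM')
  interpret PT: prob_space "Pi\<^sub>M T M'" by (intro prob_space_PiM pM')
  interpret pair_sigma_finite "Pi\<^sub>M S M'" "Pi\<^sub>M T M'" ..
  note [measurable] = A[unfolded P_eq] h[unfolded P_eq]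
  have mrg [measurable]: "merge S T \<in> Pi\<^sub>M S M' \<Otimes>\<^sub>M Pi\<^sub>M T M' \<rightarrow>\<^sub>M P"
    unfolding P_def by simp
  have split: "(\<integral>\<^sup>+x. f x \<partial>P) = (\<integral>\<^sup>+u. \<integral>\<^sup>+v. f (merge S T (u, v)) \<partial>Pi\<^sub>M T M' \<partial>Pi\<^sub>M S M')"
    if "f \<in> borel_measurable P" for f
    unfolding P_def by (rule product_nn_integral_fold) (use ST that in \<open>auto simp: P_def\<close>)
  have ovr [measurable]: "(\<lambda>(\<alpha>, x). override_on \<alpha> x S) \<in> P \<Otimes>\<^sub>M P \<rightarrow>\<^sub>M P"
    using measurable_override_on[OF S, of M] unfolding P_eq .
  have hm [measurable]: "(\<lambda>x. h (merge S T x)) \<in> borel_measurable (Pi\<^sub>M S M' \<Otimes>\<^sub>M Pi\<^sub>M T M')"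
    by measurable
  define H where "H v = (\<integral>\<^sup>+u. h (merge S T (u, v)) \<partial>Pi\<^sub>M S M')" for v
  have H [measurable]: "H \<in> borel_measurable (Pi\<^sub>M T M')"
    unfolding H_def by measurable
  \<comment> \<open>Any \<open>v0\<close> will do: \<open>A\<close> ignores the coordinates in
    \<open>T\<close>, so fixing them makes its indicator a function of \<open>u\<close>
    alone.\<close>
  obtain v0 where v0: "v0 \<in> space (Pi\<^sub>M T M')" using PT.not_empty by blast
  have spm: "merge S T (u, v) \<in> space P"
    if "u \<in> space (Pi\<^sub>M S M')" "v \<in> space (Pi\<^sub>M T M')" for u v
    by (rule measurable_space[OF mrg]) (use that in \<open>simp add: space_pair_measure\<close>)
  define e :: "'a assignment \<Rightarrow> ennreal" where "e u = indicator A (merge S T (u, v0))" for u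
  have ind: "indicator A (merge S T (u, v)) = e u"
    if "u \<in> space (Pi\<^sub>M S M')" "v \<in> space (Pi\<^sub>M T M')" for u v
  proof -
    have "\<forall>i\<in>S. merge S T (u, v) i = merge S T (u, v0) i" by (simp add: merge_def)
    then have "merge S T (u, v) \<in> A \<longleftrightarrow> merge S T (u, v0) \<in> A"
      using det spm[OF that] spm[OF that(1) v0] unfolding determined_by_def P_eq by blast
    then show ?thesis by (simp add: e_def indicator_def)
  qed
  have inner: "(\<integral>\<^sup>+x. h (override_on (merge S T (u, v)) x S) \<partial>P) = H v"
    if uv: "u \<in> space (Pi\<^sub>M S M')" "v \<in> space (Pi\<^sub>M T M')" for u v
  proof -
    have eq: "override_on (merge S T (u, v)) (merge S T (u', v')) S = merge S T (u', v)" for u' v'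
      using ST by (auto simp: override_on_def merge_def fun_eq_iff)
    have "(\<lambda>x. override_on (merge S T (u, v)) x S) \<in> P \<rightarrow>\<^sub>M P"
      using measurable_compose[OF measurable_Pair1'[OF spm[OF uv]] ovr] by simp
    then have "(\<lambda>x. h (override_on (merge S T (u, v)) x S)) \<in> borel_measurable P"
      by measurable
    then show ?thesis
      by (subst split) (simp_all add: eq H_def PT.emeasure_space_1)
  qed
  have o: "(\<lambda>\<alpha>. \<integral>\<^sup>+x. h (override_on \<alpha> x S) \<partial>P) \<in> borel_measurable P"
  proof -
    interpret P: prob_space P unfolding P_def by (intro prob_space_PiM pM')
    have "(\<lambda>(\<alpha>, x). h (override_on \<alpha> x S)) \<in> borel_measurable (P \<Otimes>\<^sub>M P)"
      using measurable_compose[OF ovr, of h borel] by (simp add: case_prod_beta)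
    then show ?thesis by (rule P.borel_measurable_nn_integral)
  qed
  have "(\<integral>\<^sup>+\<alpha>. \<integral>\<^sup>+x. indicator A \<alpha> * h (override_on \<alpha> x S) \<partial>P \<partial>P) =
      (\<integral>\<^sup>+\<alpha>. indicator A \<alpha> * (\<integral>\<^sup>+x. h (override_on \<alpha> x S) \<partial>P) \<partial>P)"
    by (intro nn_integral_cong) (auto simp: indicator_def)
  also have "\<dots> = (\<integral>\<^sup>+u. \<integral>\<^sup>+v. e u * H v \<partial>Pi\<^sub>M T M' \<partial>Pi\<^sub>M S M')"
    using o by (subst split) (auto intro!: nn_integral_cong simp: inner ind)
  also have "\<dots> = (\<integral>\<^sup>+u. e u \<partial>Pi\<^sub>M S M') * (\<integral>\<^sup>+v. H v \<partial>Pi\<^sub>M T M')"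
  proof -
    have [measurable]: "(\<lambda>u. merge S T (u, v0)) \<in> Pi\<^sub>M S M' \<rightarrow>\<^sub>M P"
      using measurable_compose[OF measurable_Pair2'[OF v0] mrg] by simp
    have "e \<in> borel_measurable (Pi\<^sub>M S M')"
      unfolding e_def by measurable
    then show ?thesis by (simp add: nn_integral_cmult nn_integral_multc)
  qed
  also have "(\<integral>\<^sup>+u. e u \<partial>Pi\<^sub>M S M') = emeasure P A"
  proof -
    have "emeasure P A = (\<integral>\<^sup>+x. indicator A x \<partial>P)" by simp
    also have "\<dots> = (\<integral>\<^sup>+u. \<integral>\<^sup>+v. e u \<partial>Pi\<^sub>M T M' \<partial>Pi\<^sub>M S M')"
      by (subst split) (simp, intro nn_integral_cong ind)
    finally show ?thesis by (simp add: PT.emeasure_space_1)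
  qed
  also have "(\<integral>\<^sup>+v. H v \<partial>Pi\<^sub>M T M') = (\<integral>\<^sup>+x. h x \<partial>P)"
    unfolding H_def using hm by (subst split) (auto intro!: Fubini')
  finally show ?thesis unfolding P_eq .
qed

text \<open>The head of the stream is the current assignment. The state after step 1 is then again a
  stream of this kind, and one measure serves before and after.\<close>

definition resample :: "nat set \<Rightarrow> 'a assignment stream \<Rightarrow> 'a assignment stream" where
  "resample S \<omega> = override_on (shd \<omega>) (shd (stl \<omega>)) S ## stl (stl \<omega>)"

lemma measurable_resample:
  assumes "S \<subseteq> {1..l}"
  shows "resample S \<in> stream_space (var_space l M) \<rightarrow>\<^sub>M stream_space (var_space l M)"
proof -
  have "(\<lambda>\<omega>. (shd \<omega>, shd (stl \<omega>))) \<in> stream_space (var_space l M) \<rightarrow>\<^sub>M var_space l M \<Otimes>\<^sub>M var_space l M"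
    by measurable
  from measurable_compose[OF this measurable_override_on[OF assms]]
  have "(\<lambda>\<omega>. override_on (shd \<omega>) (shd (stl \<omega>)) S) \<in> stream_space (var_space l M) \<rightarrow>\<^sub>M var_space l M"
    by simp
  then show ?thesis unfolding resample_def[abs_def] by measurable
qed

text \<open>Only the first two elements enter the resampling. Integrating out the rest of the stream
  turns \<open>G\<close> into a function \<open>h\<close> of the new head, to which
  \<open>nn_integral_resample\<close> applies.\<close>

lemma emeasure_resample:
  fixes M :: "nat \<Rightarrow> 'a measure"
  assumes M: "\<And>i. i \<in> {1..l} \<Longrightarrow> prob_space (M i)"
    and S: "S \<subseteq> {1..l}"
    and A [measurable]: "A \<in> sets (var_space l M)"
    and det: "determined_by (var_space l M) A S"
    and G [measurable]: "G \<in> sets (stream_space (var_space l M))"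
  shows "emeasure (stream_space (var_space l M))
      {\<omega> \<in> space (stream_space (var_space l M)). shd \<omega> \<in> A \<and> resample S \<omega> \<in> G} =
    emeasure (var_space l M) A * emeasure (stream_space (var_space l M)) G"
proof -
  define P where "P = var_space l M"
  interpret P: prob_space P unfolding P_def by (intro prob_space_PiM M)
  note [measurable] = A[folded P_def] G[folded P_def]
  have res [measurable]: "resample S \<in> stream_space P \<rightarrow>\<^sub>M stream_space P"
    unfolding P_def by (rule measurable_resample[OF S])
  define h where "h \<beta> = (\<integral>\<^sup>+\<omega>. indicator G (\<beta> ## \<omega>) \<partial>stream_space P)" for \<beta>
  have h [measurable]: "h \<in> borel_measurable P"
  proof -
    interpret Q: prob_space "stream_space P" by (rule P.prob_space_stream_space)
    show ?thesis unfolding h_def by measurable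
  qed
  define B where "B = {\<omega> \<in> space (stream_space P). shd \<omega> \<in> A \<and> resample S \<omega> \<in> G}"
  have B [measurable]: "B \<in> sets (stream_space P)"
    unfolding B_def by measurable
  have two: "(\<integral>\<^sup>+\<omega>. indicator B (\<alpha> ## \<omega>) \<partial>stream_space P) =
      (\<integral>\<^sup>+x. indicator A \<alpha> * h (override_on \<alpha> x S) \<partial>P)" if a: "\<alpha> \<in> space P" for \<alpha>
  proof -
    have "(\<lambda>\<omega>. indicator B (\<alpha> ## \<omega>) :: ennreal) \<in> borel_measurable (stream_space P)"
      using a by measurable
    then have "(\<integral>\<^sup>+\<omega>. indicator B (\<alpha> ## \<omega>) \<partial>stream_space P) =
        (\<integral>\<^sup>+x. \<integral>\<^sup>+\<omega>. indicator B (\<alpha> ## x ## \<omega>) \<partial>stream_space P \<partial>P)"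
      by (rule P.nn_integral_stream_space)
    also have "\<dots> = (\<integral>\<^sup>+x. indicator A \<alpha> * h (override_on \<alpha> x S) \<partial>P)"
    proof (rule nn_integral_cong)
      fix x assume x: "x \<in> space P"
      have "(\<integral>\<^sup>+\<omega>. indicator B (\<alpha> ## x ## \<omega>) \<partial>stream_space P) =
        (\<integral>\<^sup>+\<omega>. (if \<alpha> \<in> A then indicator G (override_on \<alpha> x S ## \<omega>) else 0) \<partial>stream_space P)"
        using a x
        by (intro nn_integral_cong) (auto simp: B_def indicator_def resample_def stream_space_Stream)
      then show "(\<integral>\<^sup>+\<omega>. indicator B (\<alpha> ## x ## \<omega>) \<partial>stream_space P) =
          indicator A \<alpha> * h (override_on \<alpha> x S)"
        by (cases "\<alpha> \<in> A") (simp_all add: h_def)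
    qed
    finally show ?thesis .
  qed
  have "emeasure (stream_space P) B = (\<integral>\<^sup>+\<omega>. indicator B \<omega> \<partial>stream_space P)"
    by simp
  also have "\<dots> = (\<integral>\<^sup>+\<alpha>. \<integral>\<^sup>+\<omega>. indicator B (\<alpha> ## \<omega>) \<partial>stream_space P \<partial>P)"
    by (rule P.nn_integral_stream_space) simp
  also have "\<dots> = (\<integral>\<^sup>+\<alpha>. \<integral>\<^sup>+x. indicator A \<alpha> * h (override_on \<alpha> x S) \<partial>P \<partial>P)"
    by (intro nn_integral_cong two)
  also have "\<dots> = emeasure P A * (\<integral>\<^sup>+x. h x \<partial>P)"
    unfolding P_def by (rule nn_integral_resample[OF M S A det h[unfolded P_def]])
  also have "(\<integral>\<^sup>+x. h x \<partial>P) = (\<integral>\<^sup>+\<omega>. indicator G \<omega> \<partial>stream_space P)"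
    unfolding h_def by (rule P.nn_integral_stream_space[symmetric]) simp
  also have "\<dots> = emeasure (stream_space P) G" by simp
  finally show ?thesis unfolding B_def P_def .
qed

section \<open>Over-approximating the runs of the algorithm\<close>

locale m_algorithm =
  fixes l m :: nat
    and M :: "nat \<Rightarrow> 'a measure"
    and E :: "nat \<Rightarrow> 'a assignment set"
    and sc :: "nat \<Rightarrow> nat set"
  assumes prob_M: "\<And>i. i \<in> {1..l} \<Longrightarrow> prob_space (M i)"
    and scope: "\<And>j. j \<in> {1..m} \<Longrightarrow> sc j \<subseteq> {1..l}"
    and E_sets: "\<And>j. j \<in> {1..m} \<Longrightarrow> E j \<in> sets (var_space l M)"
    and E_det: "\<And>j. j \<in> {1..m} \<Longrightarrow> determined_by (var_space l M) (E j) (sc j)"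
begin

declare One_nat_def [simp del]

definition P :: "'a assignment measure" where "P = var_space l M"

definition Q :: "'a assignment stream measure" where "Q = stream_space P"

definition \<Gamma> :: "nat \<Rightarrow> nat set" where "\<Gamma> = out_nbhd m P E sc"

sublocale P: prob_space P
  unfolding P_def by (intro prob_space_PiM prob_M)

sublocale Q: prob_space Q
  unfolding Q_def by (rule P.prob_space_stream_space)

lemma \<Gamma>_subset: "\<Gamma> j \<subseteq> {1..m}"
  unfolding \<Gamma>_def by (rule out_nbhd_subset)

lemma Stream_in_space_Q: "\<alpha> ## \<omega> \<in> space Q \<longleftrightarrow> \<alpha> \<in> space P \<and> \<omega> \<in> space Q"
  by (simp add: Q_def stream_space_Stream)

lemma resample_in_space:
  assumes "j \<in> {1..m}" "\<omega> \<in> space Q"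
  shows "resample (sc j) \<omega> \<in> space Q"
  using measurable_space[OF measurable_resample[OF scope[OF assms(1)]]] assms(2)
  by (simp add: Q_def P_def)

text \<open>
  \<open>call_runs n k Rs\<close> over-approximates the streams whose head is the current assignment, in which
  \<open>E k\<close> occurs, and from which the algorithm, about to resample \<open>E k\<close>, makes at least \<open>n\<close> more
  rounds. A frame of the control stack is represented by the set \<open>R\<close> of those indices its while loop
  may still select; the last set of \<open>Rs\<close> belongs to the main loop. In \<open>scan_runs b K Rs\<close> the topmost
  loop is about to test its events, \<open>K\<close> stands for \<open>call_runs n\<close>, and \<open>b\<close> for \<open>n = 0\<close>. The choice of
  the least occurring event is relaxed to an arbitrary choice of an index in \<open>R\<close>.
\<close>

primrec scan_runs ::
    "bool \<Rightarrow> (nat \<Rightarrow> nat set list \<Rightarrow> 'a assignment stream set) \<Rightarrow> nat set list \<Rightarrow> 'a assignment stream set"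
  where
  "scan_runs b K [] = (if b then space Q else {})"
| "scan_runs b K (R # Rs) = scan_runs b K Rs \<union> (\<Union>k\<in>R. K k ((R \<inter> {k<..}) # Rs))"

primrec call_runs :: "nat \<Rightarrow> nat \<Rightarrow> nat set list \<Rightarrow> 'a assignment stream set" where
  "call_runs 0 k Rs = space Q"
| "call_runs (Suc n) k Rs = {\<omega> \<in> space Q. shd \<omega> \<in> E k \<and>
     resample (sc k) \<omega> \<in> call_runs n k Rs \<union> scan_runs (n = 0) (call_runs n) (\<Gamma> k # Rs)}"

lemma space_subset_scan_runs: "space Q \<subseteq> scan_runs True K Rs"
  by (induction Rs) auto

text \<open>
  \<open>simulates D Rs s\<close>: if no event outside \<open>D\<close> occurs when control is at the top of \<open>s\<close>, then every
  loop of \<open>s\<close> will only ever find occurring events whose indices are in the corresponding set of \<open>Rs\<close>.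
\<close>

inductive simulates :: "nat set \<Rightarrow> nat set list \<Rightarrow> frame list \<Rightarrow> bool" where
  root: "D \<subseteq> R \<Longrightarrow> simulates D [R] []"
| frame: "j \<in> {1..m} \<Longrightarrow> D \<inter> \<Gamma> j \<subseteq> R \<Longrightarrow> D - \<Gamma> j \<subseteq> D' \<Longrightarrow> simulates D' Rs s \<Longrightarrow> simulates D (R # Rs) (Scan j # s)"

definition occurring :: "'a assignment \<Rightarrow> nat set" where
  "occurring \<alpha> = {i \<in> {1..m}. \<alpha> \<in> E i}"

text \<open>The pair \<alpha>, \<beta> itself witnesses the d-dependency. This is where the
  definition of d-dependency enters the proof.\<close>

lemma new_occurring_in_\<Gamma>:
  assumes "k \<in> {1..m}" "\<alpha> \<in> space P" "\<beta> \<in> space P" "\<alpha> \<in> E k" "\<beta> \<notin> E k"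
    and "\<And>i. i \<notin> sc k \<Longrightarrow> \<beta> i = \<alpha> i"
  shows "occurring \<beta> - occurring \<alpha> \<subseteq> \<Gamma> k"
proof
  fix i assume i: "i \<in> occurring \<beta> - occurring \<alpha>"
  then have "d_dependent P E sc i k"
    using assms unfolding d_dependent_def occurring_def by blast
  then show "i \<in> \<Gamma> k"
    using i assms(1) by (simp add: \<Gamma>_def out_nbhd_def d_dependency_graph_def occurring_def)
qed

text \<open>
  In the second part \<open>\<alpha>'\<close> is the assignment at the start of the current chain of step 2 calls for
  \<open>E k\<close>: an intermediate resampling may make events outside \<open>\<Gamma> k\<close> occur as long as \<open>E k\<close> still occurs,
  so d-dependency can only be applied to the two ends of the chain.
\<close>

lemma simulation:
  shows scan_simulation: "simulates D Rs s \<Longrightarrow> occurring \<alpha> \<subseteq> D \<Longrightarrow> \<alpha> ## \<omega> \<in> space Q \<Longrightarrow>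
      n + r \<le> rounds ((m_step m E sc \<Gamma> ^^ t) (s, \<alpha>, \<omega>, r)) \<Longrightarrow>
      \<alpha> ## \<omega> \<in> scan_runs (n = 0) (call_runs n) Rs"
    and call_simulation: "simulates D Rs s \<Longrightarrow> k \<in> {1..m} \<Longrightarrow> \<alpha> \<in> E k \<Longrightarrow> \<alpha>' \<in> space P \<Longrightarrow> \<alpha>' \<in> E k \<Longrightarrow>
      (\<And>i. i \<notin> sc k \<Longrightarrow> \<alpha> i = \<alpha>' i) \<Longrightarrow> occurring \<alpha>' - {k} \<subseteq> D \<Longrightarrow> \<alpha> ## \<omega> \<in> space Q \<Longrightarrow>
      n + r \<le> rounds ((m_step m E sc \<Gamma> ^^ t) (Call k # s, \<alpha>, \<omega>, r)) \<Longrightarrow>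
      \<alpha> ## \<omega> \<in> call_runs n k Rs"
proof (induction t arbitrary: D Rs s \<alpha> \<omega> n r k \<alpha>')
  \<comment> \<open>Without a machine step no round is made, which forces \<open>n = 0\<close>; both
    over-approximations then contain all of \<open>space Q\<close>.\<close>
  case 0
  {
    case 1
    then show ?case using space_subset_scan_runs by (auto simp: rounds_def)
  next
    case 2
    then show ?case by (auto simp: rounds_def)
  }
next
  case (Suc t)
  note scan = Suc.IH(1) and call = Suc.IH(2)
  {
    case 1
    note occ = 1(2) and sp = 1(3) and rd = 1(4)[unfolded funpow_Suc_right comp_def]
    have sp': "\<alpha> \<in> space P" using sp by (simp add: Stream_in_space_Q)
    have push: "\<alpha> ## \<omega> \<in> scan_runs (n = 0) (call_runs n) Rs"
      if Rs: "Rs = R # Rs'" and ex: "\<exists>k\<in>A. \<alpha> \<in> E k" and A: "A \<subseteq> {1..m}" "occurring \<alpha> \<inter> A \<subseteq> R"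
        and sim': "\<And>k. occurring \<alpha> \<inter> A \<subseteq> {k..} \<Longrightarrow> simulates (occurring \<alpha> - {k}) ((R \<inter> {k<..}) # Rs') s"
        and step: "m_step m E sc \<Gamma> (s, \<alpha>, \<omega>, r) = (Call (least_occurring E A \<alpha>) # s, \<alpha>, \<omega>, r)"
      for R Rs' A
    proof -
      define k where "k = least_occurring E A \<alpha>"
      have k: "k \<in> A" "\<alpha> \<in> E k" unfolding k_def using least_occurring_mem[OF ex] by auto
      have km: "k \<in> {1..m}" using k A by blast
      then have "k \<in> R" using k A by (auto simp: occurring_def)
      have "occurring \<alpha> \<inter> A \<subseteq> {k..}"
        unfolding k_def least_occurring_def occurring_def by (auto intro: Least_le)
      then have "simulates (occurring \<alpha> - {k}) ((R \<inter> {k<..}) # Rs') s" by (rule sim')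
      moreover have "n + r \<le> rounds ((m_step m E sc \<Gamma> ^^ t) (Call k # s, \<alpha>, \<omega>, r))"
        using rd step by (simp add: k_def)
      ultimately have "\<alpha> ## \<omega> \<in> call_runs n k ((R \<inter> {k<..}) # Rs')"
        using call[OF _ km k(2) sp' k(2) refl order.refl sp] by blast
      with \<open>k \<in> R\<close> show ?thesis unfolding Rs by auto
    qed
    from 1(1) show ?case
    proof cases
      case (root R)
      show ?thesis
      proof (cases "\<exists>k\<in>{1..m}. \<alpha> \<in> E k")
        case True
        show ?thesis
          by (rule push[OF root(1) True])
            (use True occ root in \<open>auto simp: occurring_def Ball_def intro!: simulates.root\<close>)
      next
        case False
        \<comment> \<open>The algorithm has stopped and the machine idles.\<close>
        then have "m_step m E sc \<Gamma> (s, \<alpha>, \<omega>, r) = (s, \<alpha>, \<omega>, r)"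
          using root by simp
        with rd have "n + r \<le> rounds ((m_step m E sc \<Gamma> ^^ t) (s, \<alpha>, \<omega>, r))" by simp
        with 1(1) occ sp show ?thesis by (rule scan)
      qed
    next
      case (frame j R D' Rs' s')
      show ?thesis
      proof (cases "\<exists>k\<in>\<Gamma> j. \<alpha> \<in> E k")
        case True
        have "simulates (occurring \<alpha> - {k}) ((R \<inter> {k<..}) # Rs') s" if "occurring \<alpha> \<inter> \<Gamma> j \<subseteq> {k..}" for k
          unfolding frame(2) using frame occ that by (intro simulates.frame[of _ _ _ D']) fastforce+
        with frame True occ show ?thesis
          by (intro push[OF frame(1) True \<Gamma>_subset]) auto
      next
        case False
        then have "m_step m E sc \<Gamma> (s, \<alpha>, \<omega>, r) = (s', \<alpha>, \<omega>, r)"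
          using frame by simp
        with rd have rd': "n + r \<le> rounds ((m_step m E sc \<Gamma> ^^ t) (s', \<alpha>, \<omega>, r))" by simp
        \<comment> \<open>The loop exits because no event of \<open>\<Gamma> j\<close> occurs, so
          the occurring indices lie in \<open>D - \<Gamma> j\<close>.\<close>
        have "occurring \<alpha> \<subseteq> D'" using False occ frame by (auto simp: occurring_def)
        from scan[OF frame(6) this sp rd'] show ?thesis unfolding frame by simp
      qed
    qed
  next
    case 2
    note k = 2(2) and ak = 2(3) and a0 = 2(4-7) and sp = 2(8) and rd = 2(9)[unfolded funpow_Suc_right comp_def]
    show ?case
    proof (cases n)
      case 0
      then show ?thesis using sp by simp
    next
      case (Suc n')
      define \<beta> where "\<beta> = override_on \<alpha> (shd \<omega>) (sc k)"
      have res: "resample (sc k) (\<alpha> ## \<omega>) = \<beta> ## stl \<omega>"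
        by (simp add: resample_def \<beta>_def)
      have sp': "\<beta> ## stl \<omega> \<in> space Q"
        using resample_in_space[OF k sp] by (simp add: res)
      have off: "\<beta> i = \<alpha>' i" if "i \<notin> sc k" for i
        using a0(3)[OF that] that by (simp add: \<beta>_def)
      have "\<beta> ## stl \<omega> \<in> call_runs n' k Rs \<union> scan_runs (n' = 0) (call_runs n') (\<Gamma> k # Rs)"
      proof (cases "\<beta> \<in> E k")
        case True
        then have "m_step m E sc \<Gamma> (Call k # s, \<alpha>, \<omega>, r) = (Call k # s, \<beta>, stl \<omega>, Suc r)"
          by (simp add: \<beta>_def)
        with rd Suc have "n' + Suc r \<le> rounds ((m_step m E sc \<Gamma> ^^ t) (Call k # s, \<beta>, stl \<omega>, Suc r))" by simp
        from call[OF 2(1) k True a0(1,2) off a0(4) sp' this] show ?thesis by simp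
      next
        case False
        then have "m_step m E sc \<Gamma> (Call k # s, \<alpha>, \<omega>, r) = (Scan k # s, \<beta>, stl \<omega>, Suc r)"
          by (simp add: \<beta>_def)
        with rd Suc have rd': "n' + Suc r \<le> rounds ((m_step m E sc \<Gamma> ^^ t) (Scan k # s, \<beta>, stl \<omega>, Suc r))" by simp
        have "\<beta> \<in> space P" using sp' by (simp add: Stream_in_space_Q)
        then have "occurring \<beta> - occurring \<alpha>' \<subseteq> \<Gamma> k"
          using False k a0 off by (intro new_occurring_in_\<Gamma>) auto
        moreover have "k \<notin> occurring \<beta>" using False by (simp add: occurring_def)
        \<comment> \<open>An index in \<open>occurring \<beta>\<close> outside
          \<open>\<Gamma> k\<close> occurred already at \<open>\<alpha>'\<close> and differs from
          \<open>k\<close>, hence lies in \<open>D\<close>.\<close>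
        ultimately have "simulates (occurring \<beta>) (\<Gamma> k # Rs) (Scan k # s)"
          using a0(4) k 2(1) by (intro simulates.frame[of _ _ _ D]) auto
        from scan[OF this order.refl sp' rd'] show ?thesis by simp
      qed
      then show ?thesis using sp ak res by (simp add: Suc)
    qed
  }
qed

text \<open>Initially the main loop may find any event, so the empty control stack is represented by
  the full index set.\<close>

lemma at_least_rounds_subset:
  "at_least_rounds m P E sc n \<subseteq> scan_runs (n = 0) (call_runs n) [{1..m}]"
proof
  fix \<omega> assume "\<omega> \<in> at_least_rounds m P E sc n"
  then obtain t where \<omega>: "\<omega> \<in> space Q"
    and t: "n \<le> rounds ((m_step m E sc \<Gamma> ^^ t) ([], shd \<omega>, stl \<omega>, 0))"
    by (auto simp: at_least_rounds_def Q_def \<Gamma>_def m_config_def)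
  have "shd \<omega> ## stl \<omega> \<in> scan_runs (n = 0) (call_runs n) [{1..m}]"
    by (rule scan_simulation[where D = "{1..m}" and s = "[]" and r = 0 and t = t])
      (use \<omega> t in \<open>auto simp: occurring_def intro: simulates.root\<close>)
  then show "\<omega> \<in> scan_runs (n = 0) (call_runs n) [{1..m}]" by simp
qed

section \<open>Measurability and the recursion for the measures\<close>

lemma scan_runs_sets:
  assumes "\<And>k Rs. k \<in> {1..m} \<Longrightarrow> set Rs \<subseteq> Pow {1..m} \<Longrightarrow> K k Rs \<in> sets Q"
    and "set Rs \<subseteq> Pow {1..m}"
  shows "scan_runs b K Rs \<in> sets Q"
  using assms(2)
proof (induction Rs)
  case (Cons R Rs)
  have R: "R \<subseteq> {1..m}" using Cons.prems by simp
  then have "finite R" using finite_subset by blast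
  moreover have "K k ((R \<inter> {k<..}) # Rs) \<in> sets Q" if "k \<in> R" for k
    using Cons.prems R that by (intro assms(1)) auto
  ultimately show ?case
    using Cons by (auto intro!: sets.Un sets.finite_UN)
qed auto

lemma call_runs_sets:
  assumes "k \<in> {1..m}" "set Rs \<subseteq> Pow {1..m}"
  shows "call_runs n k Rs \<in> sets Q"
  using assms
proof (induction n arbitrary: k Rs)
  case (Suc n)
  have "scan_runs (n = 0) (call_runs n) (\<Gamma> k # Rs) \<in> sets Q"
    using Suc.prems(2) \<Gamma>_subset by (intro scan_runs_sets Suc.IH) auto
  with Suc.IH[OF Suc.prems]
  have [measurable]: "call_runs n k Rs \<union> scan_runs (n = 0) (call_runs n) (\<Gamma> k # Rs) \<in> sets Q"
    by (rule sets.Un)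
  have [measurable]: "E k \<in> sets P" using E_sets[OF Suc.prems(1)] by (simp add: P_def)
  have [measurable]: "resample (sc k) \<in> Q \<rightarrow>\<^sub>M Q"
    unfolding Q_def P_def by (rule measurable_resample[OF scope[OF Suc.prems(1)]])
  have [measurable]: "shd \<in> Q \<rightarrow>\<^sub>M P" unfolding Q_def by simp
  show ?case unfolding call_runs.simps by measurable
qed simp

text \<open>By \<open>emeasure_resample\<close>, conditioning on \<open>E k\<close> costs its
  probability and leaves a stream distributed like a fresh one.\<close>

lemma measure_call_runs_Suc:
  assumes "k \<in> {1..m}" "set Rs \<subseteq> Pow {1..m}"
  shows "measure Q (call_runs (Suc n) k Rs) = measure P (E k) *
    measure Q (call_runs n k Rs \<union> scan_runs (n = 0) (call_runs n) (\<Gamma> k # Rs))"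
proof -
  have "scan_runs (n = 0) (call_runs n) (\<Gamma> k # Rs) \<in> sets Q"
    using assms(2) \<Gamma>_subset by (intro scan_runs_sets call_runs_sets) auto
  with call_runs_sets[OF assms]
  have G: "call_runs n k Rs \<union> scan_runs (n = 0) (call_runs n) (\<Gamma> k # Rs) \<in> sets Q"
    by (rule sets.Un)
  show ?thesis
    using emeasure_resample[OF prob_M scope[OF assms(1)] E_sets[OF assms(1)] E_det[OF assms(1)]
        G[unfolded Q_def P_def]]
    unfolding measure_def call_runs.simps Q_def P_def by (simp add: enn2real_mult)
qed

section \<open>Weighted counting over control stacks\<close>

context
  fixes q :: "nat \<Rightarrow> real"
  assumes q_pos: "\<And>j. j \<in> {1..m} \<Longrightarrow> 0 < q j"
begin

text \<open>Expanding each inner product gives one term for every subset of \<open>R\<close>, that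
  is, for every set of calls the loop may still make.\<close>

definition weight :: "nat set list \<Rightarrow> real" where
  "weight Rs = (\<Prod>R\<leftarrow>Rs. \<Prod>i\<in>R. 1 + q i)"

lemma weight_simps [simp]:
  "weight [] = 1" "weight (R # Rs) = (\<Prod>i\<in>R. 1 + q i) * weight Rs"
  by (simp_all add: weight_def)

lemma weight_ge_1: "set Rs \<subseteq> Pow {1..m} \<Longrightarrow> 1 \<le> weight Rs"
proof (induction Rs)
  case (Cons R Rs)
  have "1 \<le> (\<Prod>i\<in>R. 1 + q i)"
    using q_pos Cons.prems by (intro prod_ge_1) (auto simp: less_imp_le subset_iff)
  moreover have "1 \<le> weight Rs" using Cons by simp
  ultimately show ?case using mult_mono[of 1 _ 1] by fastforce
qed simp

text \<open>A union bound: the topmost loop either exits or selects some \<open>k\<close>, and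
  \<open>prod_one_plus_eq_sum\<close> collapses the resulting sum. Abstracting \<open>K\<close>
  separates this induction on the stack from the one on \<open>n\<close>.\<close>

lemma measure_scan_runs_le:
  assumes K: "\<And>k Rs. k \<in> {1..m} \<Longrightarrow> set Rs \<subseteq> Pow {1..m} \<Longrightarrow>
      K k Rs \<in> sets Q \<and> measure Q (K k Rs) \<le> x * (q k * weight Rs)"
    and x: "0 \<le> x" "b \<Longrightarrow> 1 \<le> x"
    and Rs: "set Rs \<subseteq> Pow {1..m}"
  shows "measure Q (scan_runs b K Rs) \<le> x * weight Rs"
  using Rs
proof (induction Rs)
  case Nil
  \<comment> \<open>An exhausted stack has measure 1 if no further round is required and 0
    otherwise; hence the condition on \<open>x\<close>.\<close>
  then show ?case using x by (auto simp: Q.prob_space)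
next
  case (Cons R Rs)
  have R: "R \<subseteq> {1..m}" and Rs: "set Rs \<subseteq> Pow {1..m}"
    using Cons.prems by auto
  have fin: "finite R" using R finite_subset by auto
  have K': "K k ((R \<inter> {k<..}) # Rs) \<in> sets Q"
    "measure Q (K k ((R \<inter> {k<..}) # Rs)) \<le> x * (q k * weight ((R \<inter> {k<..}) # Rs))" if "k \<in> R" for k
    using K[of k "(R \<inter> {k<..}) # Rs"] R Rs that by (auto simp: subset_iff)
  have "scan_runs b K Rs \<in> sets Q" using K Rs by (intro scan_runs_sets) auto
  then have "measure Q (scan_runs b K (R # Rs)) \<le>
      measure Q (scan_runs b K Rs) + measure Q (\<Union>k\<in>R. K k ((R \<inter> {k<..}) # Rs))"
    using K' fin unfolding scan_runs.simps by (intro measure_Un_le) auto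
  also have "\<dots> \<le> x * weight Rs + (\<Sum>k\<in>R. x * (q k * weight ((R \<inter> {k<..}) # Rs)))"
    using Cons.IH[OF Rs] K' fin
    by (intro add_mono order.trans[OF measure_UNION_le] sum_mono) auto
  also have "\<dots> = x * weight (R # Rs)"
    using prod_one_plus_eq_sum[OF fin, of q]
    by (simp add: algebra_simps sum_distrib_left sum_distrib_right)
  finally show ?case .
qed

text \<open>A repeated call for \<open>k\<close> contributes \<open>q k\<close>, entering its loop
  contributes the product over \<open>\<Gamma> k\<close>, and the slack inequality bounds both
  together at one factor \<open>c\<close> per round.\<close>

lemma measure_call_runs_le:
  assumes c: "0 < c" and slack: "\<And>j. j \<in> {1..m} \<Longrightarrow>
      measure P (E j) * (q j + (\<Prod>i\<in>\<Gamma> j. 1 + q i)) \<le> c * q j"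
    and C: "1 \<le> C" "\<And>j. j \<in> {1..m} \<Longrightarrow> 1 \<le> C * q j"
    and k: "k \<in> {1..m}" and Rs: "set Rs \<subseteq> Pow {1..m}"
  shows "measure Q (call_runs n k Rs) \<le> C * c ^ n * (q k * weight Rs)"
  using k Rs
proof (induction n arbitrary: k Rs)
  case 0
  have "1 * 1 \<le> (C * q k) * weight Rs"
    using C(2)[OF 0(1)] weight_ge_1[OF 0(2)] by (intro mult_mono) auto
  then show ?case by (simp add: Q.prob_space algebra_simps)
next
  case (Suc n)
  have \<Gamma>Rs: "set (\<Gamma> k # Rs) \<subseteq> Pow {1..m}"
    using Suc.prems(2) \<Gamma>_subset by simp
  have scan: "measure Q (scan_runs (n = 0) (call_runs n) (\<Gamma> k # Rs)) \<le> C * c ^ n * weight (\<Gamma> k # Rs)"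
    using C c Suc.IH call_runs_sets by (intro measure_scan_runs_le \<Gamma>Rs) auto
  have "measure Q (call_runs n k Rs \<union> scan_runs (n = 0) (call_runs n) (\<Gamma> k # Rs)) \<le>
      C * c ^ n * (q k * weight Rs) + C * c ^ n * weight (\<Gamma> k # Rs)"
    by (intro order.trans[OF measure_Un_le] add_mono scan Suc.IH call_runs_sets scan_runs_sets
        Suc.prems \<Gamma>Rs)
  then have "measure Q (call_runs (Suc n) k Rs) \<le>
      measure P (E k) * (C * c ^ n * (q k * weight Rs) + C * c ^ n * weight (\<Gamma> k # Rs))"
    unfolding measure_call_runs_Suc[OF Suc.prems] by (intro mult_left_mono) auto
  also have "\<dots> = (measure P (E k) * (q k + (\<Prod>i\<in>\<Gamma> k. 1 + q i))) * (C * c ^ n * weight Rs)"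
    by (simp add: algebra_simps)
  also have "\<dots> \<le> (c * q k) * (C * c ^ n * weight Rs)"
    using slack[OF Suc.prems(1)] C c weight_ge_1[OF Suc.prems(2)] by (intro mult_right_mono) auto
  finally show ?case by (simp add: algebra_simps)
qed

end

theorem at_least_rounds_exponential_tail:
  fixes chi :: "nat \<Rightarrow> real"
  assumes chi: "\<And>j. j \<in> {1..m} \<Longrightarrow> 0 < chi j \<and> chi j < 1"
    and p: "\<And>j. j \<in> {1..m} \<Longrightarrow> measure P (E j) \<le> chi j * (\<Prod>i\<in>\<Gamma> j. 1 - chi i)"
  shows "\<exists>C c :: real. C > 0 \<and> 0 < c \<and> c < 1 \<and>
    (\<forall>n. measure Q (at_least_rounds m P E sc n) \<le> C * c ^ n)"
proof -
  obtain q c where qc: "0 < c \<and> c < 1 \<and> (\<forall>j\<in>{1..m}. 0 < q j \<and>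
      measure P (E j) * (q j + (\<Prod>i\<in>\<Gamma> j. 1 + q i)) \<le> c * q j)"
    using cluster_weights[OF finite_atLeastAtMost \<Gamma>_subset measure_nonneg chi p] by blast
  then have c: "0 < c" "c < 1" and q_pos: "\<And>j. j \<in> {1..m} \<Longrightarrow> 0 < q j"
    and slack: "\<And>j. j \<in> {1..m} \<Longrightarrow> measure P (E j) * (q j + (\<Prod>i\<in>\<Gamma> j. 1 + q i)) \<le> c * q j"
    by blast+
  \<comment> \<open>Both kinds of entries serve the case \<open>n = 0\<close>:
    \<open>1 / q j\<close> for a pending call, 1 for the exhausted stack.\<close>
  define C where "C = Max (insert 1 ((\<lambda>j. 1 / q j) ` {1..m}))"
  have C1: "1 \<le> C" by (simp add: C_def)
  have Cq: "1 \<le> C * q j" if "j \<in> {1..m}" for j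
  proof -
    have "1 / q j \<le> C" unfolding C_def using that by (intro Max_ge) auto
    then show ?thesis using q_pos[OF that] by (simp add: divide_le_eq)
  qed
  let ?Rs = "[{1..m}]"
  have W: "1 \<le> weight q ?Rs" using q_pos by (intro weight_ge_1) auto
  have "measure Q (at_least_rounds m P E sc n) \<le> (C * weight q ?Rs) * c ^ n" for n
  proof -
    have "measure Q (at_least_rounds m P E sc n) \<le> measure Q (scan_runs (n = 0) (call_runs n) ?Rs)"
      by (intro Q.finite_measure_mono at_least_rounds_subset scan_runs_sets call_runs_sets) auto
    also have "\<dots> \<le> C * c ^ n * weight q ?Rs"
      using C1 Cq c slack q_pos
      by (intro measure_scan_runs_le conjI call_runs_sets measure_call_runs_le) auto
    finally show ?thesis by (simp add: algebra_simps)
  qed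
  moreover have "0 < C * weight q ?Rs" using C1 W by simp
  ultimately show ?thesis using c by blast
qed

end

theorem mainTheorem2:
  fixes l m :: nat
    and M :: "nat \<Rightarrow> 'a measure"
    and E :: "nat \<Rightarrow> 'a assignment set"
    and sc :: "nat \<Rightarrow> nat set"
    and chi :: "nat \<Rightarrow> real"
  assumes "\<And>i. i \<in> {1..l} \<Longrightarrow> prob_space (M i)"
    and "\<And>j. j \<in> {1..m} \<Longrightarrow> sc j \<subseteq> {1..l}"
    and "\<And>j. j \<in> {1..m} \<Longrightarrow> E j \<in> sets (var_space l M)"
    and "\<And>j. j \<in> {1..m} \<Longrightarrow> determined_by (var_space l M) (E j) (sc j)"
    and "\<And>j. j \<in> {1..m} \<Longrightarrow> measure (var_space l M) (E j) < 1"
    and "\<And>j. j \<in> {1..m} \<Longrightarrow> 0 < chi j \<and> chi j < 1"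
    and "\<And>j. j \<in> {1..m} \<Longrightarrow>
           measure (var_space l M) (E j) \<le>
             chi j * (\<Prod>i\<in>out_nbhd m (var_space l M) E sc j. 1 - chi i)"
  shows "\<exists>C c :: real. C > 0 \<and> 0 < c \<and> c < 1 \<and>
           (\<forall>n\<ge>1. measure (stream_space (var_space l M))
                     (at_least_rounds m (var_space l M) E sc n) \<le> C * c ^ n)"
proof -
  interpret m_algorithm l m M E sc
    by (rule m_algorithm.intro[OF assms(1-4)])
  show ?thesis
    using at_least_rounds_exponential_tail[of chi, unfolded Q_def \<Gamma>_def P_def, OF assms(6,7)] by blast
qed

end
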